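(* Let $n \geq 1$ be an integer and let $f\colon \mathbb{R}^n \to \mathbb{R}$ be an arbitrary function (not assumed to be continuous). Then $f$ is horizontally rigid via translations if and only if there exists $\vec{r} \in \mathbb{R}^n$ such that $f$ is constant on every open halfline starting from $\vec{r}$.
   Context: For a function $f\colon \mathbb{R}^n \to \mathbb{R}$, $\operatorname{graph}(f) = \{(\vec{x}, f(\vec{x})) : \vec{x} \in \mathbb{R}^n\} \subseteq \mathbb{R}^{n+1}$, and for $c \in (0,\infty)$, $f(c\,\cdot)$ denotes the function $\vec{x} \mapsto f(c\vec{x})$. The function $f$ is called horizontally rigid via translations if for every $c \in (0,\infty)$ there exists a translation $\varphi$ of $\mathbb{R}^{n+1}$ such that $\varphi(\operatorname{graph}(f)) = \operatorname{graph}(f(c\,\cdot))$. An open halfline starting from $\vec{r}$ is a set of the form $\{\vec{r} + t\vec{e} : t > 0\}$ with $\vec{e} \in \mathbb{R}^n \setminus \{\vec{0}\}$ (so the endpoint $\vec{r}$ is excluded); the constant value of $f$ may differ from halfline to halfline. *)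

theory Defs
  imports "HOL-Analysis.Analysis"
begin

(* R^(n+1) is represented as the product space R^n x R, as for the library's epigraph. *)

definition fun_graph :: "('a \<Rightarrow> 'b) \<Rightarrow> ('a \<times> 'b) set" where
  "fun_graph f = {(x, f x) | x. True}"

definition is_translation :: "('a::ab_group_add \<Rightarrow> 'a) \<Rightarrow> bool" where
  "is_translation \<phi> \<longleftrightarrow> (\<exists>v. \<forall>p. \<phi> p = p + v)"

definition horizontally_rigid_via_translations :: "(real ^ 'n \<Rightarrow> real) \<Rightarrow> bool" where
  "horizontally_rigid_via_translations f \<longleftrightarrow>
     (\<forall>c>0. \<exists>\<phi> :: (real ^ 'n) \<times> real \<Rightarrow> (real ^ 'n) \<times> real.
        is_translation \<phi> \<and> \<phi> ` fun_graph f = fun_graph (\<lambda>x. f (c *\<^sub>R x)))"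

definition is_open_halfline_from :: "'a::real_vector \<Rightarrow> 'a set \<Rightarrow> bool" where
  "is_open_halfline_from r H \<longleftrightarrow> (\<exists>e. e \<noteq> 0 \<and> H = {r + t *\<^sub>R e | t. t > 0})"

end

theory Submission
  imports Defs
begin

text \<open>Rigidity means that for every \<open>c > 0\<close> some homothety \<open>g\<close> of ratio \<open>c\<close> changes \<open>f\<close> only by an
  additive constant. If \<open>c \<noteq> 1\<close>, evaluating at the fixed point of \<open>g\<close> shows that this constant is
  \<open>0\<close>, so \<open>f \<circ> g = f\<close>. Let \<open>r\<close> be the fixed point of the homothety of ratio \<open>2\<close>. Its commutator with
  \<open>g\<close> is a translation by a period of \<open>f\<close>, and this period is exactly the vector by which \<open>g\<close> differs
  from the homothety of ratio \<open>c\<close> about \<open>r\<close>. Hence \<open>f\<close> is invariant under all homotheties about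
  \<open>r\<close>.\<close>

lemma translation_image_fun_graph_eq_iff:
  fixes f g :: "'a::ab_group_add \<Rightarrow> 'b::ab_group_add"
  assumes "\<And>p. \<phi> p = p + (u, a)"
  shows "\<phi> ` fun_graph f = fun_graph g \<longleftrightarrow> (\<forall>x. g (x + u) = f x + a)"
proof
  assume eq: "\<phi> ` fun_graph f = fun_graph g"
  show "\<forall>x. g (x + u) = f x + a"
  proof
    fix x
    have "\<phi> (x, f x) \<in> \<phi> ` fun_graph f"
      by (auto simp: fun_graph_def)
    then show "g (x + u) = f x + a"
      unfolding eq by (simp add: assms fun_graph_def)
  qed
next
  assume g: "\<forall>x. g (x + u) = f x + a"
  show "\<phi> ` fun_graph f = fun_graph g"
  proof (intro equalityI subsetI)
    fix p assume "p \<in> \<phi> ` fun_graph f"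
    then show "p \<in> fun_graph g"
      using g by (auto simp: assms fun_graph_def)
  next
    fix p assume "p \<in> fun_graph g"
    then obtain y where "p = (y, g y)"
      by (auto simp: fun_graph_def)
    moreover have "g y = f (y - u) + a"
      using g[rule_format, of "y - u"] by simp
    ultimately have "p = \<phi> (y - u, f (y - u))"
      by (simp add: assms)
    then show "p \<in> \<phi> ` fun_graph f"
      by (auto simp: fun_graph_def)
  qed
qed

text \<open>A horizontal shift by \<open>u\<close> before scaling is a shift by
  \<open>c *\<^sub>R u\<close> after it, so \<open>v\<close> stands for \<open>c *\<^sub>R u\<close>
  and translations of the graph become affine substitutions in \<open>f\<close>.\<close>

lemma horizontally_rigid_via_translations_iff:
  "horizontally_rigid_via_translations f \<longleftrightarrow>
     (\<forall>c>0. \<exists>v a. \<forall>x. f (c *\<^sub>R x + v) = f x + a)"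
proof -
  have "(\<exists>\<phi>. is_translation \<phi> \<and> \<phi> ` fun_graph f = fun_graph (\<lambda>x. f (c *\<^sub>R x))) \<longleftrightarrow>
        (\<exists>v a. \<forall>x. f (c *\<^sub>R x + v) = f x + a)" (is "?L \<longleftrightarrow> ?R") if "c > 0" for c
  proof
    assume ?L
    then obtain \<phi> t where "\<And>p. \<phi> p = p + t"
      and "\<phi> ` fun_graph f = fun_graph (\<lambda>x. f (c *\<^sub>R x))"
      unfolding is_translation_def by blast
    moreover obtain u a where "t = (u, a)"
      by (cases t)
    ultimately have "f (c *\<^sub>R x + c *\<^sub>R u) = f x + a" for x
      by (simp add: translation_image_fun_graph_eq_iff scaleR_add_right)
    then show ?R
      by blast
  next
    assume ?R
    then obtain v a where va: "\<And>x. f (c *\<^sub>R x + v) = f x + a"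
      by blast
    \<comment> \<open>The horizontal part \<open>u\<close> has to satisfy
      \<open>c *\<^sub>R u = v\<close>.\<close>
    define \<phi> where "\<phi> p = p + (v /\<^sub>R c, a)" for p
    have "\<phi> ` fun_graph f = fun_graph (\<lambda>x. f (c *\<^sub>R x))"
      using that va
      by (simp add: translation_image_fun_graph_eq_iff[OF \<phi>_def] scaleR_add_right)
    moreover have "is_translation \<phi>"
      by (auto simp: is_translation_def \<phi>_def)
    ultimately show ?L
      by blast
  qed
  then show ?thesis
    by (simp add: horizontally_rigid_via_translations_def)
qed

text \<open>The open halfline from \<open>r\<close> through a point other than \<open>r\<close> is
  the orbit of that point under the homotheties of positive ratio about \<open>r\<close>, while
  \<open>r\<close> itself is fixed by all of them.\<close>

lemma constant_on_open_halflines_iff: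
  "(\<forall>H. is_open_halfline_from r H \<longrightarrow> f constant_on H) \<longleftrightarrow>
     (\<forall>c>0. \<forall>x. f (r + c *\<^sub>R (x - r)) = f x)"
proof (intro iffI allI impI)
  fix c :: real and x
  assume const: "\<forall>H. is_open_halfline_from r H \<longrightarrow> f constant_on H" and "c > 0"
  show "f (r + c *\<^sub>R (x - r)) = f x"
  proof (cases "x = r")
    case False
    define H where "H = {r + t *\<^sub>R (x - r) | t. t > 0}"
    have "is_open_halfline_from r H"
      unfolding is_open_halfline_from_def H_def using False by (intro exI[of _ "x - r"]) simp
    then have "f constant_on H"
      using const by blast
    moreover have "r + c *\<^sub>R (x - r) \<in> H"
      using \<open>c > 0\<close> by (auto simp: H_def)
    moreover have "x \<in> H"
      unfolding H_def by (auto intro!: exI[of _ 1])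
    ultimately show ?thesis
      by (auto simp: constant_on_def)
  qed simp
next
  fix H
  assume inv: "\<forall>c>0. \<forall>x. f (r + c *\<^sub>R (x - r)) = f x" and "is_open_halfline_from r H"
  then obtain e where H: "H = {r + t *\<^sub>R e | t. t > 0}"
    by (auto simp: is_open_halfline_from_def)
  have "f (r + t *\<^sub>R e) = f (r + e)" if "t > 0" for t
    using inv[rule_format, OF that, of "r + e"] by simp
  then show "f constant_on H"
    by (auto simp: constant_on_def H)
qed

lemma homothety_additive_constant_eq_0:
  fixes f :: "'a::real_vector \<Rightarrow> 'b::ab_group_add"
  assumes "c \<noteq> 1" and eq: "\<And>x. f (c *\<^sub>R x + v) = f x + a"
  shows "a = 0"
proof -
  \<comment> \<open>The fixed point, found by solving \<open>c *\<^sub>R p + v = p\<close>.\<close>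
  define p where "p = v /\<^sub>R (1 - c)"
  have "(1 - c) *\<^sub>R p = v"
    using \<open>c \<noteq> 1\<close> by (simp add: p_def)
  then have "c *\<^sub>R p + v = p"
    by (auto simp: algebra_simps)
  then show ?thesis
    using eq[of p] by simp
qed

text \<open>Let \<open>h x = 2 *\<^sub>R x - r\<close>, with fixed point \<open>r\<close>, and
  \<open>g x = c *\<^sub>R x + v\<close>. Then \<open>h (g z) - g (h z)\<close> is the vector
  \<open>w\<close> for every \<open>z\<close>, and \<open>f\<close> takes the value
  \<open>f z\<close> at both points.\<close>

lemma homothety_invariant_imp_common_center:
  fixes f :: "'a::real_vector \<Rightarrow> 'b"
  assumes "c \<noteq> 0" and two: "\<And>x. f (2 *\<^sub>R x - r) = f x" and eq: "\<And>x. f (c *\<^sub>R x + v) = f x"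
  shows "f (r + c *\<^sub>R (x - r)) = f x"
proof -
  define w where "w = v - (1 - c) *\<^sub>R r"
  have period: "f (y + w) = f y" for y
  proof -
    \<comment> \<open>Chosen so that \<open>h (g z) = y + w\<close>; then
      \<open>g (h z) = y\<close>.\<close>
    define z where "z = (y + w - 2 *\<^sub>R v + r) /\<^sub>R (2 * c)"
    have cz: "(2 * c) *\<^sub>R z = y + w - 2 *\<^sub>R v + r"
      using \<open>c \<noteq> 0\<close> by (simp add: z_def)
    have "f (y + w) = f (2 *\<^sub>R (c *\<^sub>R z + v) - r)"
      using cz by (simp add: scaleR_add_right)
    also have "\<dots> = f (c *\<^sub>R (2 *\<^sub>R z - r) + v)"
      by (simp add: two eq)
    also have "c *\<^sub>R (2 *\<^sub>R z - r) + v = y"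
    proof -
      have "c *\<^sub>R (2 *\<^sub>R z - r) + v = (2 * c) *\<^sub>R z - c *\<^sub>R r + v"
        by (simp add: scaleR_diff_right mult.commute)
      also have "\<dots> = y"
        unfolding cz w_def by (simp add: algebra_simps scaleR_2)
      finally show ?thesis .
    qed
    finally show ?thesis .
  qed
  have "f (r + c *\<^sub>R (x - r)) = f (r + c *\<^sub>R (x - r) + w)"
    by (simp add: period)
  also have "r + c *\<^sub>R (x - r) + w = c *\<^sub>R x + v"
    by (simp add: w_def algebra_simps)
  finally show ?thesis
    by (simp add: eq)
qed

theorem theorem3p2:
  fixes f :: "real ^ 'n \<Rightarrow> real"
  shows "horizontally_rigid_via_translations f \<longleftrightarrow>
    (\<exists>r. \<forall>H. is_open_halfline_from r H \<longrightarrow> f constant_on H)"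
  unfolding horizontally_rigid_via_translations_iff constant_on_open_halflines_iff
proof
  assume rigid: "\<forall>c>0. \<exists>v a. \<forall>x. f (c *\<^sub>R x + v) = f x + a"
  have invariant: "\<exists>v. \<forall>x. f (c *\<^sub>R x + v) = f x" if c: "c > 0" for c
  proof (cases "c = 1")
    case True
    \<comment> \<open>A ratio of 1 gives no fixed point to evaluate at, but the identity map serves
      as the homothety.\<close>
    then show ?thesis
      by (intro exI[of _ 0]) simp
  next
    case False
    obtain v a where va: "\<And>x. f (c *\<^sub>R x + v) = f x + a"
      using rigid c by blast
    then have "a = 0"
      by (rule homothety_additive_constant_eq_0[OF False])
    then show ?thesis
      using va by auto
  qed
  obtain u where "\<And>x. f (2 *\<^sub>R x + u) = f x"
    using invariant[of 2] by auto
  \<comment> \<open>The common center will be \<open>- u\<close>, the fixed point of the homothety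
    of ratio 2.\<close>
  then have two: "f (2 *\<^sub>R x - (- u)) = f x" for x
    by simp
  have "f (- u + c *\<^sub>R (x - - u)) = f x" if c: "c > 0" for c x
  proof -
    obtain v where "\<And>x. f (c *\<^sub>R x + v) = f x"
      using invariant[OF c] by blast
    with two show ?thesis
      using c by (intro homothety_invariant_imp_common_center) auto
  qed
  then show "\<exists>r. \<forall>c>0. \<forall>x. f (r + c *\<^sub>R (x - r)) = f x"
    by blast
next
  assume "\<exists>r. \<forall>c>0. \<forall>x. f (r + c *\<^sub>R (x - r)) = f x"
  then obtain r where "\<And>c x. c > 0 \<Longrightarrow> f (r + c *\<^sub>R (x - r)) = f x"
    by blast
  \<comment> \<open>Expanding the homothety about \<open>r\<close> gives
    \<open>v = r - c *\<^sub>R r\<close>, with additive constant 0.\<close>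
  then have "f (c *\<^sub>R x + (r - c *\<^sub>R r)) = f x + 0" if "c > 0" for c x
    using that by (metis add.commute add.right_neutral add_diff_eq diff_add_eq scaleR_diff_right)
  then show "\<forall>c>0. \<exists>v a. \<forall>x. f (c *\<^sub>R x + v) = f x + a"
    by blast
qed

end
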